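(* Let $n\ge1$ and let $k_1,\dots,k_n$ be the numbers of column interpolation points in the variables $s_1,\dots,s_n$. In the recursive 1-D procedure (defined in the context) for computing a null vector of the $n$-D Loewner matrix, one only needs to construct sequentially single 1-D Loewner matrices, each of dimension $k_l\times k_l$ for some $l\in\{1,\dots,n\}$. The largest stored matrix has dimension $k_{\max}\times k_{\max}$, where $k_{\max}=\max_{1\le l\le n}k_l$. In complex double precision, the maximum disk storage is $\frac{16}{2^{20}}k_{\max}^2$ MB.
   Context: For a function $\mathcal H(s_1,\dots,s_n)$ evaluated at column points $\lambda^{(l)}_1,\dots,\lambda^{(l)}_{k_l}$ and row points $\mu^{(l)}_1,\dots,\mu^{(l)}_{k_l}$ ($l=1,\dots,n$), the $n$-D Loewner matrix has, in row $(i_1,\dots,i_n)$ and column $(j_1,\dots,j_n)$, the entry $\frac{\mathcal H(\mu^{(1)}_{i_1},\dots,\mu^{(n)}_{i_n})-\mathcal H(\lambda^{(1)}_{j_1},\dots,\lambda^{(n)}_{j_n})}{\prod_l(\mu^{(l)}_{i_l}-\lambda^{(l)}_{j_l})}$. A Loewner matrix with some variables frozen is the Loewner matrix of the function obtained by fixing those variables. Recursive procedure for a null vector in the variables $s_1,\dots,s_n$: (i) if $n=1$, compute a null vector of the $k_1\times k_1$ 1-D Loewner matrix; (ii) if $n\ge2$, compute a null vector of the single $k_1\times k_1$ 1-D Loewner matrix in $s_1$ with $s_2,\dots,s_n$ frozen at $\lambda^{(2)}_{k_2},\dots,\lambda^{(n)}_{k_n}$, and, for each of the $k_1$ values $s_1=\lambda^{(1)}_j$,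 compute (by the same procedure applied to the variables $s_2,\dots,s_n$) a null vector of the $(n-1)$-D Loewner matrix with $s_1$ frozen at $\lambda^{(1)}_j$; these are then combined by scaling and stacking. The 1-D Loewner matrices are processed one at a time, so only one is stored at any time; the storage counted is that of the Loewner matrices only. Convention: a complex double-precision number occupies 16 bytes, and 1 MB is $2^{20}$ bytes. *)

theory Defs
  imports "Jordan_Normal_Form.Matrix_Kernel" "HOL-Library.Multiset"
begin

section \<open>Loewner matrices\<close>

text \<open>
  The interpolation points are given as one pair per variable: the list of column points
  \<open>\<lambda>\<^sup>(\<^sup>l\<^sup>)\<close> and the list of row points \<open>\<mu>\<^sup>(\<^sup>l\<^sup>)\<close>.  A function of \<open>n\<close> complex variables is a
  function on lists of which only the values at lists of length \<open>n\<close> matter.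
  Rows and columns of the \<open>n\<close>-D Loewner matrix are numbered by the multi-indices in
  lexicographic order, the first variable being the most significant one; this is the
  order in which \<open>product_lists\<close> enumerates the grid.
\<close>

type_synonym points = "complex list \<times> complex list"

definition loewner :: "(complex list \<Rightarrow> complex) \<Rightarrow> points list \<Rightarrow> complex mat" where
  "loewner H ps =
     (let cs = product_lists (map fst ps); rs = product_lists (map snd ps)
      in mat (length rs) (length cs)
           (\<lambda>(i, j). (H (rs ! i) - H (cs ! j)) / (\<Prod>l<length ps. rs ! i ! l - cs ! j ! l)))"

section \<open>Storage\<close>

text \<open>
  The store contains Loewner matrices only.  It is a multiset, so that a matrix stored twice
  is counted twice.
\<close>

datatype event = Construct "complex mat" | Discard "complex mat"

fun apply_event :: "event \<Rightarrow> complex mat multiset \<Rightarrow> complex mat multiset" where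
  "apply_event (Construct A) M = add_mset A M"
| "apply_event (Discard A) M = M - {#A#}"

definition constructed :: "event list \<Rightarrow> complex mat set" where
  "constructed es = {A. Construct A \<in> set es}"

definition store_at :: "event list \<Rightarrow> nat \<Rightarrow> complex mat multiset" where
  "store_at es t = fold apply_event (take t es) {#}"

definition stored :: "event list \<Rightarrow> complex mat set" where
  "stored es = (\<Union>t\<le>length es. set_mset (store_at es t))"

text \<open>A complex double-precision number occupies 16 bytes, and 1 MB is \<open>2^20\<close> bytes.\<close>

definition storage_MB :: "complex mat multiset \<Rightarrow> real" where
  "storage_MB M = real (\<Sum>A\<in>#M. 16 * (dim_row A * dim_col A)) / 2 ^ 20"

definition max_storage_MB :: "event list \<Rightarrow> real" where
  "max_storage_MB es = Max ((\<lambda>t. storage_MB (store_at es t)) ` {..length es})"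

section \<open>The recursive procedure\<close>

text \<open>
  The subroutine computing a null vector of a given matrix is arbitrary, except that it
  returns the zero vector only if there is no other null vector.
\<close>

definition null_solver :: "(complex mat \<Rightarrow> complex vec) \<Rightarrow> bool" where
  "null_solver nv \<longleftrightarrow>
     (\<forall>A. nv A \<in> mat_kernel A \<and>
          (mat_kernel A \<noteq> {0\<^sub>v (dim_col A)} \<longrightarrow> nv A \<noteq> 0\<^sub>v (dim_col A)))"

definition process :: "(complex mat \<Rightarrow> complex vec) \<Rightarrow> complex mat \<Rightarrow> complex vec \<times> event list" where
  "process nv A = (nv A, [Construct A, Discard A])"

text \<open>
  The \<open>j\<close>-th block, obtained for \<open>s\<^sub>1 = \<lambda>\<^sup>(\<^sup>1\<^sup>)\<^sub>j\<close>, is scaled so that its last entry, which belongs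
  to the values at which \<open>s\<^sub>2, \<dots>, s\<^sub>n\<close> are frozen in the computation of \<open>c\<close>, becomes \<open>c $ j\<close>.
\<close>

definition scale_stack :: "complex vec \<Rightarrow> complex vec list \<Rightarrow> complex vec" where
  "scale_stack c bs =
     vec_of_list (concat (map (\<lambda>j. list_of_vec ((c $ j / (bs ! j) $ (dim_vec (bs ! j) - 1)) \<cdot>\<^sub>v (bs ! j)))
                              [0..<length bs]))"

text \<open>
  The result is the computed vector together with the chronological list of the
  constructions and deletions of Loewner matrices.  The equation for the empty list
  (\<open>n = 0\<close>) is a dummy.
\<close>

fun recursive_null ::
  "(complex mat \<Rightarrow> complex vec) \<Rightarrow> (complex list \<Rightarrow> complex) \<Rightarrow> points list
     \<Rightarrow> complex vec \<times> event list" where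
  "recursive_null nv H [] = (vNil, [])"
| "recursive_null nv H [p] = process nv (loewner H [p])"
| "recursive_null nv H (p # q # ps) =
     (let (c, es) = process nv (loewner (\<lambda>z. H (z @ map (last \<circ> fst) (q # ps))) [p]);
          rs = map (\<lambda>x. recursive_null nv (\<lambda>z. H (x # z)) (q # ps)) (fst p)
      in (scale_stack c (map fst rs), es @ concat (map snd rs)))"

section \<open>Indexed interpolation points\<close>

definition axis_points ::
  "(nat \<Rightarrow> nat) \<Rightarrow> (nat \<Rightarrow> nat \<Rightarrow> complex) \<Rightarrow> (nat \<Rightarrow> nat \<Rightarrow> complex) \<Rightarrow> nat \<Rightarrow> points" where
  "axis_points k lam mu l = (map (lam l) [1..<Suc (k l)], map (mu l) [1..<Suc (k l)])"

definition grid_points ::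
  "nat \<Rightarrow> (nat \<Rightarrow> nat) \<Rightarrow> (nat \<Rightarrow> nat \<Rightarrow> complex) \<Rightarrow> (nat \<Rightarrow> nat \<Rightarrow> complex) \<Rightarrow> points list" where
  "grid_points n k lam mu = map (axis_points k lam mu) [1..<Suc n]"

text \<open>
  1-D Loewner matrix in the variable \<open>s\<^sub>l\<close>, every other variable \<open>s\<^sub>i\<close> being frozen at the
  column point with index \<open>j i\<close>.
\<close>

definition loewner_1D ::
  "nat \<Rightarrow> (nat \<Rightarrow> nat) \<Rightarrow> (nat \<Rightarrow> nat \<Rightarrow> complex) \<Rightarrow> (nat \<Rightarrow> nat \<Rightarrow> complex)
     \<Rightarrow> (complex list \<Rightarrow> complex) \<Rightarrow> nat \<Rightarrow> (nat \<Rightarrow> nat) \<Rightarrow> complex mat" where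
  "loewner_1D n k lam mu H l j =
     loewner (\<lambda>z. H (map (\<lambda>i. if i = l then hd z else lam i (j i)) [1..<Suc n]))
             [axis_points k lam mu l]"

end

theory Submission
  imports Defs
begin

text \<open>
  Every run of the procedure produces an event list in which each construction of a matrix is
  immediately followed by its deletion, so the store is always empty or a single matrix.  Each
  matrix is a slice in one variable with the others frozen at column points: the earlier ones
  by the recursion, the later ones at the last column point.  As every set of column points is
  nonempty, each variable contributes a matrix, hence so does the one with the most points.
\<close>

section \<open>Loewner matrices in one variable\<close>

lemma loewner_single_carrier:
  "loewner G [p] \<in> carrier_mat (length (snd p)) (length (fst p))"
  by (simp add: loewner_def Let_def)

text \<open>A 1-D matrix evaluates its function at one-element lists only. Hence appending frozen
  values to \<open>z\<close> and overwriting one slot by \<open>hd z\<close> give the same matrix,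
  although they differ on lists of other lengths.\<close>

lemma loewner_single_cong:
  assumes "\<And>x. G [x] = G' [x]"
  shows "loewner G [p] = loewner G' [p]"
  using assms by (auto simp: loewner_def Let_def comp_def intro!: eq_matI)

section \<open>Event lists that hold one matrix at a time\<close>

definition construct_discard :: "complex mat list \<Rightarrow> event list" where
  "construct_discard As = concat (map (\<lambda>A. [Construct A, Discard A]) As)"

lemma constructed_construct_discard: "constructed (construct_discard As) = set As"
  by (auto simp: constructed_def construct_discard_def)

lemma construct_discard_Cons:
  "construct_discard (A # As) = Construct A # Discard A # construct_discard As"
  by (simp add: construct_discard_def)

lemma construct_discard_concat:
  "construct_discard (concat Bs) = concat (map construct_discard Bs)"
  by (induction Bs) (simp_all add: construct_discard_def)

text \<open>Two events bring the store back to empty, so the induction shifts time by two. Letting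
  time run over all naturals keeps the length of the list out of the induction.\<close>

lemma store_at_construct_discard:
  "range (store_at (construct_discard As)) = insert {#} ((\<lambda>A. {#A#}) ` set As)"
proof (induction As)
  case Nil
  show ?case by (auto simp: store_at_def construct_discard_def)
next
  case (Cons A As)
  let ?s = "store_at (construct_discard (A # As))"
  have 0: "?s 0 = {#}" and 1: "?s (Suc 0) = {#A#}"
    and 2: "?s (Suc (Suc t)) = store_at (construct_discard As) t" for t
    by (simp_all add: store_at_def construct_discard_def)
  \<comment> \<open>Time splits into before, during and after the storage of
    \<open>A\<close>.\<close>
  have UNIV: "(UNIV :: nat set) = insert 0 (insert (Suc 0) (range (\<lambda>t. Suc (Suc t))))"
  proof -
    have "t \<in> insert 0 (insert (Suc 0) (range (\<lambda>t. Suc (Suc t))))" for t :: nat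
      by (cases t rule: nat.exhaust; cases "t - 1") auto
    then show ?thesis by blast
  qed
  have "range ?s = insert {#} (insert {#A#} (range (store_at (construct_discard As))))"
    by (subst UNIV) (simp only: image_insert image_image 0 1 2)
  with Cons.IH show ?case by auto
qed

text \<open>Past the end, \<open>take\<close> returns the whole list and the store stays constant.
  This links the bounded times in \<open>stored\<close> and \<open>max_storage_MB\<close> to the
  unbounded ones above.\<close>

lemma store_at_image: "store_at es ` {..length es} = range (store_at es)"
proof -
  have "store_at es t = store_at es (min t (length es))" for t
    by (auto simp: store_at_def min_def)
  then have "store_at es t \<in> store_at es ` {..length es}" for t
    by (rule image_eqI) simp
  then show ?thesis by blast
qed

lemma stored_construct_discard: "stored (construct_discard As) = set As"
proof -
  have "stored (construct_discard As) = \<Union> (set_mset ` range (store_at (construct_discard As)))"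
    unfolding stored_def store_at_image[symmetric] by (simp add: image_image)
  then show ?thesis by (auto simp: store_at_construct_discard)
qed

text \<open>The element 0 is the size of the empty store; it also keeps the set nonempty when
  \<open>As\<close> is empty.\<close>

lemma max_storage_construct_discard:
  "max_storage_MB (construct_discard As) =
     Max (insert 0 ((\<lambda>A. 16 * (real (dim_row A) * real (dim_col A)) / 2 ^ 20) ` set As))"
proof -
  have image: "(\<lambda>t. storage_MB (store_at es t)) ` {..length es} = storage_MB ` range (store_at es)" for es
    unfolding store_at_image[symmetric] by (simp only: image_image)
  show ?thesis
    unfolding max_storage_MB_def image store_at_construct_discard
    by (simp add: image_image storage_MB_def)
qed

section \<open>The event list of the recursion\<close>

lemma recursive_null_events:
  "\<exists>As. snd (recursive_null nv H ps) = construct_discard As"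
proof (induction ps arbitrary: H)
  case Nil
  show ?case by (auto simp: construct_discard_def)
next
  case (Cons p ps)
  show ?case
  proof (cases ps)
    case Nil
    then show ?thesis
      by (auto simp: process_def construct_discard_def intro: exI[of _ "[_]"])
  next
    case (Cons q qs)
    have "\<forall>x. \<exists>As. snd (recursive_null nv (\<lambda>z. H (x # z)) ps) = construct_discard As"
      by (intro allI Cons.IH)
    then obtain f
      where f: "\<And>x. snd (recursive_null nv (\<lambda>z. H (x # z)) ps) = construct_discard (f x)"
      unfolding choice_iff by blast
    have "snd (recursive_null nv H (p # ps)) =
        construct_discard (loewner (\<lambda>z. H (z @ map (last \<circ> fst) ps)) [p] # concat (map f (fst p)))"
      using f unfolding Cons
      by (simp add: process_def Let_def comp_def construct_discard_concat
        construct_discard_Cons)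
    then show ?thesis by blast
  qed
qed

section \<open>The matrices that the recursion constructs\<close>

lemma constructed_recursive_null_Cons:
  assumes "ps \<noteq> []"
  shows "constructed (snd (recursive_null nv H (p # ps))) =
    insert (loewner (\<lambda>z. H (z @ map (last \<circ> fst) ps)) [p])
      (\<Union>x\<in>set (fst p). constructed (snd (recursive_null nv (\<lambda>z. H (x # z)) ps)))"
  using assms by (cases ps) (auto simp: constructed_def process_def Let_def)

lemma constructed_recursive_null_single:
  "constructed (snd (recursive_null nv H [p])) = {loewner H [p]}"
  by (auto simp: constructed_def process_def)

text \<open>Here \<open>xs\<close> is a point of the column grid whose slot \<open>i\<close> is
  overwritten by the free variable; a placeholder column point in that slot lets one
  \<open>list_all2\<close> cover all coordinates.\<close>

lemma constructed_recursive_null_slice: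
  assumes "A \<in> constructed (snd (recursive_null nv H ps))" "\<forall>p\<in>set ps. fst p \<noteq> []"
  shows "\<exists>i<length ps. \<exists>xs. list_all2 (\<lambda>x p. x \<in> set (fst p)) xs ps \<and>
           A = loewner (\<lambda>z. H (xs[i := hd z])) [ps ! i]"
  using assms
proof (induction ps arbitrary: H)
  case Nil
  then show ?case by (simp add: constructed_def)
next
  case (Cons p ps)
  \<comment> \<open>The slice in the first variable. Nonemptiness makes each \<open>last\<close> a
    genuine column point; for empty \<open>ps\<close> nothing is appended, so this also covers the
    base case of the procedure.\<close>
  have head: ?case if A: "A = loewner (\<lambda>z. H (z @ map (last \<circ> fst) ps)) [p]"
  proof (intro exI[of _ 0] exI[of _ "map (last \<circ> fst) (p # ps)"] conjI)
    show "list_all2 (\<lambda>x p. x \<in> set (fst p)) (map (last \<circ> fst) (p # ps)) (p # ps)"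
      using Cons.prems(2) by (auto simp: list_all2_conv_all_nth nth_Cons split: nat.split)
    show "A = loewner (\<lambda>z. H ((map (last \<circ> fst) (p # ps))[0 := hd z])) [(p # ps) ! 0]"
      unfolding A nth_Cons_0 by (rule loewner_single_cong) simp
  qed simp
  show ?case
  proof (cases "ps = []")
    case True
    then have "A = loewner H [p]"
      using Cons.prems(1)
      by (simp add: constructed_recursive_null_single del: recursive_null.simps)
    then show ?thesis by (intro head) (simp add: True)
  next
    case False
    then consider "A = loewner (\<lambda>z. H (z @ map (last \<circ> fst) ps)) [p]"
      | x where "x \<in> set (fst p)" "A \<in> constructed (snd (recursive_null nv (\<lambda>z. H (x # z)) ps))"
      using Cons.prems(1) by (auto simp: constructed_recursive_null_Cons)
    then show ?thesis
    proof cases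
      case 1
      then show ?thesis by (rule head)
    next
      case 2
      then obtain i xs where "i < length ps" "list_all2 (\<lambda>x p. x \<in> set (fst p)) xs ps"
        "A = loewner (\<lambda>z. H (x # xs[i := hd z])) [ps ! i]"
        using Cons.IH[of "\<lambda>z. H (x # z)"] Cons.prems(2) by auto
      with 2(1) show ?thesis by (intro exI[of _ "Suc i"] exI[of _ "x # xs"] conjI) auto
    qed
  qed
qed

text \<open>The head variable gets its matrix directly; for a later one, a column point of the head
  exists and triggers a recursive call. The function \<open>G\<close> stays unspecified because the
  dimension depends on \<open>p\<close> alone.\<close>

lemma constructed_recursive_null_all_variables:
  assumes "p \<in> set ps" "\<forall>p\<in>set ps. fst p \<noteq> []"
  shows "\<exists>G. loewner G [p] \<in> constructed (snd (recursive_null nv H ps))"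
  using assms
proof (induction ps arbitrary: H)
  case (Cons q ps)
  show ?case
  proof (cases "ps = []")
    case True
    with Cons.prems show ?thesis
      by (auto simp: constructed_recursive_null_single simp del: recursive_null.simps)
  next
    case False
    show ?thesis
    proof (cases "p = q")
      case True
      then show ?thesis using False by (auto simp: constructed_recursive_null_Cons)
    next
      case neq: False
      from Cons.prems(2) obtain x where "x \<in> set (fst q)" by (cases "fst q") auto
      moreover obtain G
        where "loewner G [p] \<in> constructed (snd (recursive_null nv (\<lambda>z. H (x # z)) ps))"
        using Cons.IH[of "\<lambda>z. H (x # z)"] Cons.prems neq by auto
      ultimately show ?thesis using False by (auto simp: constructed_recursive_null_Cons)
    qed
  qed
qed simp

section \<open>From list positions to indices of variables and points\<close>

lemma constructed_recursive_null_grid: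
  assumes "\<And>l. l \<in> {1..n} \<Longrightarrow> k l \<ge> 1"
    and "A \<in> constructed (snd (recursive_null nv H (grid_points n k lam mu)))"
  shows "\<exists>l\<in>{1..n}. \<exists>j. (\<forall>i\<in>{1..n}. j i \<in> {1..k i}) \<and> A = loewner_1D n k lam mu H l j"
proof -
  let ?ps = "grid_points n k lam mu"
  have "\<forall>p\<in>set ?ps. fst p \<noteq> []"
    using assms(1) by (force simp: grid_points_def axis_points_def)
  then obtain i xs where i: "i < length ?ps"
    and xs: "list_all2 (\<lambda>x p. x \<in> set (fst p)) xs ?ps"
    and A: "A = loewner (\<lambda>z. H (xs[i := hd z])) [?ps ! i]"
    using constructed_recursive_null_slice[OF assms(2)] by blast
  have len: "length ?ps = n" "length xs = n"
    using list_all2_lengthD[OF xs] by (simp_all add: grid_points_def)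
  have nth: "?ps ! m = axis_points k lam mu (Suc m)" if "m < n" for m
    using that by (simp add: grid_points_def del: upt_Suc)
  \<comment> \<open>Variables count from 1 and list positions from 0. Each coordinate is a column
    point, so it has an index; these indices are collected into \<open>j\<close>.\<close>
  have "\<exists>a\<in>{1..k m}. xs ! (m - 1) = lam m a" if "m \<in> {1..n}" for m
  proof -
    have "xs ! (m - 1) \<in> set (fst (axis_points k lam mu m))"
      using list_all2_nthD[OF xs, of "m - 1"] that len nth[of "m - 1"]
      by (cases m) auto
    then show ?thesis by (auto simp: axis_points_def simp del: upt_Suc)
  qed
  then obtain j where j: "\<And>m. m \<in> {1..n} \<Longrightarrow> j m \<in> {1..k m} \<and> xs ! (m - 1) = lam m (j m)"
    by metis
  have "map (\<lambda>m. if m = Suc i then y else lam m (j m)) [1..<Suc n] = xs[i := y]" for y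
  proof (rule nth_equalityI)
    fix m
    assume "m < length (map (\<lambda>m. if m = Suc i then y else lam m (j m)) [1..<Suc n])"
    then have "m < n" by (simp del: upt_Suc)
    then show "map (\<lambda>m. if m = Suc i then y else lam m (j m)) [1..<Suc n] ! m = xs[i := y] ! m"
      using j[of "Suc m"] len by (auto simp: nth_list_update simp del: upt_Suc)
  qed (simp add: len del: upt_Suc)
  then have "A = loewner_1D n k lam mu H (Suc i) j"
    using A i len nth by (simp add: loewner_1D_def del: upt_Suc)
  with i len j show ?thesis by (intro bexI[of _ "Suc i"] exI[of _ j]) auto
qed

section \<open>Dimensions and the storage maximum\<close>

lemma loewner_1D_carrier: "loewner_1D n k lam mu H l j \<in> carrier_mat (k l) (k l)"
  using loewner_single_carrier[of _ "axis_points k lam mu l"]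
  by (simp add: loewner_1D_def axis_points_def del: upt_Suc)

theorem theorem5p6:
  fixes n :: nat and k :: "nat \<Rightarrow> nat"
    and lam mu :: "nat \<Rightarrow> nat \<Rightarrow> complex"
    and H :: "complex list \<Rightarrow> complex"
    and nv :: "complex mat \<Rightarrow> complex vec"
    and kmax :: nat and es :: "event list"
  assumes "n \<ge> 1"
    and "\<And>l. l \<in> {1..n} \<Longrightarrow> k l \<ge> 1"
    and "\<And>l i j. l \<in> {1..n} \<Longrightarrow> i \<in> {1..k l} \<Longrightarrow> j \<in> {1..k l} \<Longrightarrow> mu l i \<noteq> lam l j"
    and "null_solver nv"
    and "kmax = Max (k ` {1..n})"
    and "es = snd (recursive_null nv H (grid_points n k lam mu))"
  shows "(\<forall>A \<in> constructed es. \<exists>l\<in>{1..n}. A \<in> carrier_mat (k l) (k l) \<and>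
            (\<exists>j. (\<forall>i\<in>{1..n}. j i \<in> {1..k i}) \<and> A = loewner_1D n k lam mu H l j))
       \<and> (\<forall>t. size (store_at es t) \<le> 1)
       \<and> (\<exists>A \<in> stored es. A \<in> carrier_mat kmax kmax)
       \<and> (\<forall>A \<in> stored es. dim_row A \<le> kmax \<and> dim_col A \<le> kmax)
       \<and> max_storage_MB es = 16 / 2 ^ 20 * (real kmax)\<^sup>2"
proof -
  obtain As where es: "es = construct_discard As"
    using recursive_null_events assms(6) by blast
  note cons = constructed_construct_discard[of As, folded es]
  have slices: "\<exists>l\<in>{1..n}. A \<in> carrier_mat (k l) (k l) \<and>
      (\<exists>j. (\<forall>i\<in>{1..n}. j i \<in> {1..k i}) \<and> A = loewner_1D n k lam mu H l j)"
    if "A \<in> constructed es" for A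
    using constructed_recursive_null_grid[of n k A nv H lam mu] assms(2) that loewner_1D_carrier
    unfolding assms(6) by blast
  have k_le: "k l \<le> kmax" if "l \<in> {1..n}" for l
    using that assms(5) by simp
  have bound: "dim_row A \<le> kmax \<and> dim_col A \<le> kmax" if "A \<in> set As" for A
    using slices[of A] that k_le unfolding cons by auto
  have "kmax \<in> k ` {1..n}"
    unfolding assms(5) using assms(1) by (intro Max_in) auto
  then obtain l where l: "l \<in> {1..n}" "k l = kmax" by auto
  \<comment> \<open>A variable attaining \<open>kmax\<close> yields the matrix \<open>B\<close>,
    which serves both as a largest stored matrix and as the witness that the storage bound is
    reached.\<close>
  have "\<exists>G. loewner G [axis_points k lam mu l] \<in> constructed es"
    unfolding assms(6)
  proof (rule constructed_recursive_null_all_variables)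
    show "axis_points k lam mu l \<in> set (grid_points n k lam mu)"
      using l(1) by (auto simp: grid_points_def simp del: upt_Suc)
    show "\<forall>p\<in>set (grid_points n k lam mu). fst p \<noteq> []"
      using assms(2) by (force simp: grid_points_def axis_points_def)
  qed
  then obtain B where B: "B \<in> set As" "B \<in> carrier_mat kmax kmax"
    using loewner_single_carrier[of _ "axis_points k lam mu l"] l(2) cons
    by (auto simp: axis_points_def simp del: upt_Suc)
  have size: "size (store_at es t) \<le> 1" for t
  proof -
    have "store_at es t \<in> insert {#} ((\<lambda>A. {#A#}) ` set As)"
      unfolding es store_at_construct_discard[symmetric] by (rule rangeI)
    then show ?thesis by auto
  qed
  have storage: "max_storage_MB es = 16 / 2 ^ 20 * (real kmax)\<^sup>2"
    unfolding es max_storage_construct_discard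
  \<comment> \<open>The upper bound comes from the dimensions of the slices, attainment from
    \<open>B\<close>.\<close>
  proof (rule Max_eqI)
    fix y
    assume "y \<in> insert 0 ((\<lambda>A. 16 * (real (dim_row A) * real (dim_col A)) / 2 ^ 20) ` set As)"
    then consider "y = 0"
      | A where "A \<in> set As" "y = 16 * (real (dim_row A) * real (dim_col A)) / 2 ^ 20"
      by blast
    then show "y \<le> 16 / 2 ^ 20 * (real kmax)\<^sup>2"
    proof cases
      case 2
      then have "real (dim_row A) * real (dim_col A) \<le> real kmax * real kmax"
        using bound by (intro mult_mono) auto
      then show ?thesis using 2 by (simp add: power2_eq_square mult.commute)
    qed simp
  next
    show "16 / 2 ^ 20 * (real kmax)\<^sup>2
        \<in> insert 0 ((\<lambda>A. 16 * (real (dim_row A) * real (dim_col A)) / 2 ^ 20) ` set As)"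
      using B by (auto intro!: rev_image_eqI[of B] simp: power2_eq_square)
  qed simp
  have "stored es = set As"
    unfolding es by (rule stored_construct_discard)
  with slices size B bound storage show ?thesis by blast
qed

end
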